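(* Let $\Sigma=(G,\sigma)$ be a signed graph and let $v$ be a non-isolated vertex of $\Sigma$. Then \[\rho(\Sigma)\le \sqrt{\rho^2(\Sigma-v)+2d(v)-1}.\] Let $\Sigma'$ be the signed graph obtained from $\Sigma$ by switching with respect to $N^-(v)$. If $d=d(v)\ge 2$, then equality holds in this inequality if and only if both of the following conditions hold: (a) $\Sigma'[N(v)]\cong (K_d,+)$ or $\Sigma'[N(v)]\cong (K_d,-)$; and (b) $\rho(\Sigma-v)=d-1$.
   Context: A signed graph $\Sigma=(G,\sigma)$ is a finite simple graph $G=(V,E)$ with a sign function $\sigma:E\to\{-1,+1\}$. Its adjacency matrix $A(\Sigma)$ is the symmetric matrix whose $(i,j)$ entry is $\sigma(v_iv_j)$ if $v_i\sim v_j$ and $0$ otherwise. With eigenvalues $\lambda_1(\Sigma)\ge\dots\ge\lambda_n(\Sigma)$ of $A(\Sigma)$, the spectral radius is $\rho(\Sigma)=\max\{\lambda_1(\Sigma),-\lambda_n(\Sigma)\}$. $\Sigma-v$ is obtained by deleting the vertex $v$ and its incident edges. $N(v)$ is the set of neighbours of $v$ in $G$, $d(v)=|N(v)|$, and $N^-(v)=\{u\in V:uv\in E,\ \sigma(uv)=-1\}$. Switching $\Sigma$ with respect to $S\subseteq V$ means reversing the signs of all edges with exactly one endpoint in $S$. $\Sigma'[N(v)]$ is the signed subgraph of $\Sigma'$ induced on $N(v)$. $(K_d,+)$ and $(K_d,-)$ denote the complete graph on $d$ vertices with all edges positive, respectively all edges negative; $\cong$ denotes isomorphism of signed graphs (sign-preserving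 graph isomorphism). *)

theory Defs
  imports "Jordan_Normal_Form.Char_Poly"
begin

text \<open>An edge is the two-element set of its endpoints. The values of \<open>sign\<close> outside \<open>edges\<close>
  carry no meaning and are never inspected by the definitions below.\<close>

record 'a signed_graph =
  verts :: "'a set"
  edges :: "'a set set"
  sign :: "'a set \<Rightarrow> int"

definition is_signed_graph :: "'a signed_graph \<Rightarrow> bool" where
  "is_signed_graph \<Sigma> \<longleftrightarrow>
     finite (verts \<Sigma>) \<and>
     (\<forall>e\<in>edges \<Sigma>. e \<subseteq> verts \<Sigma> \<and> card e = 2 \<and> sign \<Sigma> e \<in> {-1, 1})"

definition neighbours :: "'a signed_graph \<Rightarrow> 'a \<Rightarrow> 'a set" where
  "neighbours \<Sigma> v = {u \<in> verts \<Sigma>. {u, v} \<in> edges \<Sigma>}"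

definition vertex_degree :: "'a signed_graph \<Rightarrow> 'a \<Rightarrow> nat" where
  "vertex_degree \<Sigma> v = card (neighbours \<Sigma> v)"

definition neg_neighbours :: "'a signed_graph \<Rightarrow> 'a \<Rightarrow> 'a set" where
  "neg_neighbours \<Sigma> v = {u \<in> verts \<Sigma>. {u, v} \<in> edges \<Sigma> \<and> sign \<Sigma> {u, v} = -1}"

definition induced :: "'a signed_graph \<Rightarrow> 'a set \<Rightarrow> 'a signed_graph" where
  "induced \<Sigma> W =
     \<lparr>verts = verts \<Sigma> \<inter> W, edges = {e \<in> edges \<Sigma>. e \<subseteq> W}, sign = sign \<Sigma>\<rparr>"

definition delete_vertex :: "'a signed_graph \<Rightarrow> 'a \<Rightarrow> 'a signed_graph" where
  "delete_vertex \<Sigma> v =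
     \<lparr>verts = verts \<Sigma> - {v}, edges = {e \<in> edges \<Sigma>. v \<notin> e}, sign = sign \<Sigma>\<rparr>"

definition switching :: "'a signed_graph \<Rightarrow> 'a set \<Rightarrow> 'a signed_graph" where
  "switching \<Sigma> S =
     \<lparr>verts = verts \<Sigma>, edges = edges \<Sigma>,
      sign = (\<lambda>e. if card (e \<inter> S) = 1 then - sign \<Sigma> e else sign \<Sigma> e)\<rparr>"

definition complete_signed_graph :: "nat \<Rightarrow> int \<Rightarrow> nat signed_graph" where
  "complete_signed_graph d s =
     \<lparr>verts = {..<d}, edges = {e. e \<subseteq> {..<d} \<and> card e = 2}, sign = (\<lambda>_. s)\<rparr>"

definition sg_isomorphic :: "'a signed_graph \<Rightarrow> 'b signed_graph \<Rightarrow> bool" where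
  "sg_isomorphic \<Sigma> \<Gamma> \<longleftrightarrow>
     (\<exists>f. bij_betw f (verts \<Sigma>) (verts \<Gamma>) \<and>
          (\<forall>u\<in>verts \<Sigma>. \<forall>w\<in>verts \<Sigma>.
             ({u, w} \<in> edges \<Sigma> \<longleftrightarrow> {f u, f w} \<in> edges \<Gamma>) \<and>
             ({u, w} \<in> edges \<Sigma> \<longrightarrow> sign \<Sigma> {u, w} = sign \<Gamma> {f u, f w})))"

definition adjacency_entry :: "'a signed_graph \<Rightarrow> 'a \<Rightarrow> 'a \<Rightarrow> real" where
  "adjacency_entry \<Sigma> u w = (if {u, w} \<in> edges \<Sigma> then of_int (sign \<Sigma> {u, w}) else 0)"

text \<open>The adjacency matrix with respect to the enumeration \<open>vs\<close> of the vertices.\<close>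

definition adjacency_matrix_wrt :: "'a list \<Rightarrow> 'a signed_graph \<Rightarrow> real mat" where
  "adjacency_matrix_wrt vs \<Sigma> =
     mat (length vs) (length vs) (\<lambda>(i, j). adjacency_entry \<Sigma> (vs ! i) (vs ! j))"

text \<open>The enumeration chosen here does not affect the eigenvalues, see
  \<open>eigenvalue_adjacency_matrix_wrt\<close> below.\<close>

definition adjacency_matrix :: "'a signed_graph \<Rightarrow> real mat" where
  "adjacency_matrix \<Sigma> =
     adjacency_matrix_wrt (SOME vs. distinct vs \<and> set vs = verts \<Sigma>) \<Sigma>"

text \<open>The matrix is real symmetric, so for a signed graph with at least one vertex its set of real
  eigenvalues is finite and nonempty, and the maximum and the minimum of that set are the first
  and the last eigenvalue in the decreasing list of all eigenvalues with multiplicity.\<close>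

definition largest_eigenvalue :: "'a signed_graph \<Rightarrow> real" where
  "largest_eigenvalue \<Sigma> = Max {k. eigenvalue (adjacency_matrix \<Sigma>) k}"

definition least_eigenvalue :: "'a signed_graph \<Rightarrow> real" where
  "least_eigenvalue \<Sigma> = Min {k. eigenvalue (adjacency_matrix \<Sigma>) k}"

definition sg_spectral_radius :: "'a signed_graph \<Rightarrow> real" where
  "sg_spectral_radius \<Sigma> = max (largest_eigenvalue \<Sigma>) (- least_eigenvalue \<Sigma>)"

lemma eigenvalue_adjacency_matrix_wrt:
  assumes "distinct vs"
  shows "eigenvalue (adjacency_matrix_wrt vs \<Sigma>) k \<longleftrightarrow>
    (\<exists>x. (\<exists>u\<in>set vs. x u \<noteq> 0) \<and>
         (\<forall>u\<in>set vs. (\<Sum>w\<in>set vs. adjacency_entry \<Sigma> u w * x w) = k * x u))"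
    (is "?L \<longleftrightarrow> ?R")
proof -
  let ?n = "length vs"
  let ?A = "adjacency_matrix_wrt vs \<Sigma>"
  have bij: "bij_betw ((!) vs) {0..<?n} (set vs)"
    using assms by (simp add: bij_betw_nth atLeast0LessThan)
  have row: "(?A *\<^sub>v vec ?n (\<lambda>i. x (vs ! i))) $ i =
      (\<Sum>w\<in>set vs. adjacency_entry \<Sigma> (vs ! i) w * x w)" if "i < ?n" for x i
    using that sum.reindex_bij_betw[OF bij, of "\<lambda>w. adjacency_entry \<Sigma> (vs ! i) w * x w"]
    by (simp add: adjacency_matrix_wrt_def scalar_prod_def)
  show ?thesis
  proof
    assume ?L
    then obtain y where y: "y \<in> carrier_vec ?n" "y \<noteq> 0\<^sub>v ?n" "?A *\<^sub>v y = k \<cdot>\<^sub>v y"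
      by (auto simp: eigenvalue_def eigenvector_def adjacency_matrix_wrt_def)
    define x where "x u = y $ (THE i. i < ?n \<and> vs ! i = u)" for u
    have the: "(THE j. j < ?n \<and> vs ! j = vs ! i) = i" if "i < ?n" for i
      using that assms by (intro the_equality) (auto simp: nth_eq_iff_index_eq)
    have x: "x (vs ! i) = y $ i" if "i < ?n" for i
      using the[OF that] by (simp add: x_def)
    have yx: "y = vec ?n (\<lambda>i. x (vs ! i))"
      using y(1) x by (intro eq_vecI) auto
    from y(1,2) obtain i where "i < ?n" "y $ i \<noteq> 0"
      by (metis carrier_vecD eq_vecI index_zero_vec)
    then have "\<exists>u\<in>set vs. x u \<noteq> 0"
      using x by (metis nth_mem)
    moreover have "(\<Sum>w\<in>set vs. adjacency_entry \<Sigma> u w * x w) = k * x u" if "u \<in> set vs" for u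
    proof -
      from that obtain i where i: "i < ?n" "u = vs ! i"
        by (metis in_set_conv_nth)
      have "(?A *\<^sub>v y) $ i = (k \<cdot>\<^sub>v y) $ i"
        using y(3) by simp
      also have "\<dots> = k * x u"
        using i y(1) x[OF i(1)] by (metis carrier_vecD index_smult_vec(1))
      finally have "(?A *\<^sub>v y) $ i = k * x u" .
      moreover have "(?A *\<^sub>v y) $ i = (\<Sum>w\<in>set vs. adjacency_entry \<Sigma> u w * x w)"
        by (subst yx) (simp only: row[OF i(1)] i(2))
      ultimately show ?thesis by (simp only:)
    qed
    ultimately show ?R by blast
  next
    assume ?R
    then obtain x u where u: "u \<in> set vs" "x u \<noteq> 0"
      and ev: "\<And>u. u \<in> set vs \<Longrightarrow> (\<Sum>w\<in>set vs. adjacency_entry \<Sigma> u w * x w) = k * x u"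
      by blast
    let ?y = "vec ?n (\<lambda>i. x (vs ! i))"
    obtain i where i: "i < ?n" "u = vs ! i"
      using u(1) by (metis in_set_conv_nth)
    have "?y \<noteq> 0\<^sub>v ?n"
    proof
      assume "?y = 0\<^sub>v ?n"
      then have "?y $ i = 0\<^sub>v ?n $ i" by simp
      then show False using i u(2) by simp
    qed
    moreover have "?A *\<^sub>v ?y = k \<cdot>\<^sub>v ?y"
    proof (rule eq_vecI)
      show "dim_vec (?A *\<^sub>v ?y) = dim_vec (k \<cdot>\<^sub>v ?y)"
        by (simp add: adjacency_matrix_wrt_def)
      fix i assume "i < dim_vec (k \<cdot>\<^sub>v ?y)"
      then have "i < ?n" by simp
      then show "(?A *\<^sub>v ?y) $ i = (k \<cdot>\<^sub>v ?y) $ i"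
        using row[of i x] ev[of "vs ! i"] by simp
    qed
    ultimately show ?L
      unfolding eigenvalue_def eigenvector_def
      by (intro exI[of _ ?y]) (auto simp: adjacency_matrix_wrt_def)
  qed
qed

end

theory Submission
  imports Defs "HOL-Analysis.Function_Topology" "Jordan_Normal_Form.Spectral_Radius"
begin

text \<open>Write \<open>\<rho>\<close> for the spectral radius of \<open>\<Sigma>\<close>, \<open>r\<close> for that of \<open>\<Sigma> - v\<close> and \<open>d\<close> for the degree of
\<open>v\<close>. Let \<open>s \<rho>\<close> with \<open>s = 1\<close> or \<open>s = -1\<close> be an eigenvalue of extreme modulus, with eigenvector
\<open>x\<close>. If \<open>x v = 0\<close>, then \<open>x\<close> restricted to the other vertices shows \<open>\<rho> \<le> r\<close>. Otherwise multiply the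
adjacency matrix by \<open>s\<close>, switch so that all entries in the row of \<open>v\<close> become nonnegative, and scale
the eigenvector to have the value \<open>1\<close> at \<open>v\<close>. Let \<open>B\<close> be the resulting matrix on the vertices other
than \<open>v\<close>, \<open>b\<close> the indicator vector of \<open>N(v)\<close>, and \<open>y\<close> the rest of the eigenvector. Then
\<open>\<rho> y = b + B y\<close> and \<open>b \<bullet> y = \<rho>\<close>. For \<open>\<rho> \<le> r\<close> the bound is clear and strict, so let \<open>\<rho> > r\<close>; then
\<open>\<rho> = b \<bullet> (\<rho> - B)\<inverse> b\<close>.

All eigenvalues \<open>t\<close> of \<open>B\<close> lie in \<open>[-r, r]\<close>, and there
\<open>1 / (\<rho> - t) \<le> (\<rho> + t) / (\<rho>\<^sup>2 - r\<^sup>2)\<close>. Hence \<open>\<rho> (\<rho>\<^sup>2 - r\<^sup>2) \<le> \<rho> d + b \<bullet> B b\<close>, which is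
\<open>bordered_key_inequality\<close>; its proof restates this comparison as the positivity of a polynomial in
\<open>B\<close>, which follows from the fact that \<open>r\<close> bounds the Rayleigh quotients of \<open>B\<close>. The number
\<open>b \<bullet> B b\<close> is at most \<open>r d\<close>, as a value of the quadratic form at a vector with \<open>b \<bullet> b = d\<close>, and at
most \<open>d (d - 1)\<close>, as a sum of that many entries in \<open>[-1, 1]\<close>. If \<open>\<rho>\<^sup>2 \<ge> r\<^sup>2 + 2 d - 1\<close>, the
first estimate forces \<open>\<rho> \<ge> d\<close>, and then the second gives \<open>\<rho>\<^sup>2 - r\<^sup>2 \<le> d + (d - 1)\<close>. Equality with
\<open>d \<ge> 2\<close> forces \<open>\<rho> = d\<close>, \<open>r = d - 1\<close> and \<open>b \<bullet> B b = d (d - 1)\<close>, so every entry of \<open>B\<close> between two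
distinct neighbours of \<open>v\<close> is \<open>1\<close>: the switched neighbourhood is complete with all signs equal to
\<open>s\<close>. These two steps are \<open>bordered_arith\<close> and \<open>bordered_bound\<close>.

Conversely, if the switched neighbourhood is complete with constant sign, then \<open>v\<close> and its neighbours
induce, up to switching, a complete graph on \<open>d + 1\<close> vertices with constant sign, so \<open>\<rho> \<ge> d\<close>
(\<open>spectral_radius_ge_complete_neighbourhood\<close>); together with \<open>r = d - 1\<close> and the upper bound this
is equality.

That the spectral radius bounds all Rayleigh quotients comes from \<open>rayleigh_maximizer\<close>, proved by
compactness of the unit sphere.\<close>

section \<open>Symmetric matrices indexed by a finite set\<close>

definition inner_on :: "'a set \<Rightarrow> ('a \<Rightarrow> real) \<Rightarrow> ('a \<Rightarrow> real) \<Rightarrow> real" where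
  "inner_on V x y = (\<Sum>u\<in>V. x u * y u)"

definition mat_app :: "'a set \<Rightarrow> ('a \<Rightarrow> 'a \<Rightarrow> real) \<Rightarrow> ('a \<Rightarrow> real) \<Rightarrow> 'a \<Rightarrow> real" where
  "mat_app V a x u = (\<Sum>w\<in>V. a u w * x w)"

lemma inner_on_commute: "inner_on V x y = inner_on V y x"
  by (simp add: inner_on_def mult.commute)

lemma inner_on_lin_left:
  "inner_on V (\<lambda>u. \<alpha> * x u + \<beta> * y u) z = \<alpha> * inner_on V x z + \<beta> * inner_on V y z"
  by (simp add: inner_on_def sum.distrib sum_distrib_left algebra_simps)

lemma inner_on_lin_right:
  "inner_on V z (\<lambda>u. \<alpha> * x u + \<beta> * y u) = \<alpha> * inner_on V z x + \<beta> * inner_on V z y"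
  using inner_on_lin_left by (metis inner_on_commute)

lemma inner_on_cong:
  assumes "\<And>u. u \<in> V \<Longrightarrow> x u = x' u" "\<And>u. u \<in> V \<Longrightarrow> y u = y' u"
  shows "inner_on V x y = inner_on V x' y'"
  unfolding inner_on_def using assms by (intro sum.cong) auto

lemma inner_on_self_nonneg: "0 \<le> inner_on V x x"
  unfolding inner_on_def by (intro sum_nonneg) auto

lemma inner_on_self_eq_0_iff:
  assumes "finite V"
  shows "inner_on V x x = 0 \<longleftrightarrow> (\<forall>u\<in>V. x u = 0)"
  unfolding inner_on_def using assms by (subst sum_nonneg_eq_0_iff) auto

lemma mat_app_lin:
  "mat_app V a (\<lambda>u. \<alpha> * x u + \<beta> * y u) = (\<lambda>u. \<alpha> * mat_app V a x u + \<beta> * mat_app V a y u)"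
  by (simp add: mat_app_def sum.distrib sum_distrib_left algebra_simps fun_eq_iff)

lemma mat_app_cong:
  assumes "\<And>u. u \<in> V \<Longrightarrow> x u = x' u"
  shows "mat_app V a x = mat_app V a x'"
  unfolding mat_app_def using assms by (intro ext sum.cong) auto

lemma mat_app_uminus: "mat_app V (\<lambda>u w. - a u w) x = (\<lambda>u. - mat_app V a x u)"
  by (simp add: mat_app_def sum_negf fun_eq_iff)

lemma mat_app_self_adjoint:
  assumes "\<And>u w. a u w = a w u"
  shows "inner_on V (mat_app V a x) y = inner_on V x (mat_app V a y)"
proof -
  have "inner_on V (mat_app V a x) y = (\<Sum>u\<in>V. \<Sum>w\<in>V. a u w * x w * y u)"
    by (simp add: inner_on_def mat_app_def sum_distrib_right)
  also have "\<dots> = (\<Sum>w\<in>V. \<Sum>u\<in>V. a u w * x w * y u)"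
    by (rule sum.swap)
  also have "\<dots> = (\<Sum>w\<in>V. \<Sum>u\<in>V. a w u * x w * y u)"
    by (subst assms) (rule refl)
  also have "\<dots> = inner_on V x (mat_app V a y)"
    by (simp add: inner_on_def mat_app_def sum_distrib_left algebra_simps)
  finally show ?thesis .
qed

text \<open>Both quadratic forms at a vector in the span of \<open>y\<close> and \<open>B y\<close>, in terms of the moments
\<open>y \<bullet> B\<^sup>i y\<close> for \<open>i \<le> 3\<close>. This turns the later positivity arguments into polynomial identities in
four real numbers.\<close>

lemma inner_on_krylov:
  fixes V :: "'a set" and \<alpha> \<beta> :: real
  assumes "\<And>u w. a u w = a w u"
  defines "B \<equiv> mat_app V a"
  defines "z y \<equiv> (\<lambda>u. \<alpha> * y u + \<beta> * B y u)"
  shows "inner_on V (z y) (z y) =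
      \<alpha>\<^sup>2 * inner_on V y y + 2 * \<alpha> * \<beta> * inner_on V y (B y) + \<beta>\<^sup>2 * inner_on V (B y) (B y)"
    and "inner_on V (z y) (B (z y)) =
      \<alpha>\<^sup>2 * inner_on V y (B y) + 2 * \<alpha> * \<beta> * inner_on V (B y) (B y) + \<beta>\<^sup>2 * inner_on V (B y) (B (B y))"
proof -
  have adj: "inner_on V y (B (B y)) = inner_on V (B y) (B y)"
    unfolding B_def by (rule mat_app_self_adjoint[symmetric]) (fact assms(1))
  have comm: "inner_on V (B y) y = inner_on V y (B y)"
    by (rule inner_on_commute)
  show "inner_on V (z y) (z y) =
      \<alpha>\<^sup>2 * inner_on V y y + 2 * \<alpha> * \<beta> * inner_on V y (B y) + \<beta>\<^sup>2 * inner_on V (B y) (B y)"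
    unfolding z_def inner_on_lin_left inner_on_lin_right comm
    by (simp add: algebra_simps power2_eq_square)
  have Bz: "B (z y) = (\<lambda>u. \<alpha> * B y u + \<beta> * B (B y) u)"
    unfolding z_def B_def by (rule mat_app_lin)
  show "inner_on V (z y) (B (z y)) =
      \<alpha>\<^sup>2 * inner_on V y (B y) + 2 * \<alpha> * \<beta> * inner_on V (B y) (B y) + \<beta>\<^sup>2 * inner_on V (B y) (B (B y))"
    unfolding Bz unfolding z_def inner_on_lin_left inner_on_lin_right adj
    by (simp add: algebra_simps power2_eq_square)
qed

text \<open>The form \<open>k - a\<close> is positive semidefinite and vanishes at \<open>x\<close>. Moving from \<open>x\<close> a little in the
direction \<open>- z\<close>, where \<open>z = (k - a) x\<close> is half its gradient, would make it negative unless \<open>z = 0\<close>.\<close>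

lemma eigenvector_of_tight_rayleigh_bound:
  assumes fin: "finite V" and sym: "\<And>u w. a u w = a w u"
    and psd: "\<And>y. inner_on V y (mat_app V a y) \<le> k * inner_on V y y"
    and tight: "inner_on V x (mat_app V a x) = k * inner_on V x x"
    and u: "u \<in> V"
  shows "mat_app V a x u = k * x u"
proof -
  define B where "B = mat_app V a"
  define z where "z = (\<lambda>u. k * x u + (-1) * B x u)"
  define p where "p = inner_on V z z"
  define q where "q = k * p - inner_on V z (B z)"
  have q0: "q \<ge> 0" using psd[of z] by (simp add: q_def p_def B_def)
  have p0: "p \<ge> 0" by (simp add: p_def inner_on_self_nonneg)
  have adj: "inner_on V z (B x) = inner_on V x (B z)"
    unfolding B_def using mat_app_self_adjoint[of a V x z, OF sym]
    by (simp add: inner_on_commute)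
  have p_eq: "p = k * inner_on V x z - inner_on V x (B z)"
  proof -
    have "p = k * inner_on V z x + (-1) * inner_on V z (B x)"
      unfolding p_def by (subst (2) z_def) (rule inner_on_lin_right)
    then show ?thesis using adj by (simp add: inner_on_commute)
  qed
  have quad: "0 \<le> 2 * t * p + t\<^sup>2 * q" for t
  proof -
    let ?w = "\<lambda>u. 1 * x u + t * z u"
    have "inner_on V ?w (B ?w) =
        inner_on V x (B x) + t * inner_on V x (B z) + t * inner_on V z (B x) + t\<^sup>2 * inner_on V z (B z)"
      unfolding B_def mat_app_lin inner_on_lin_left inner_on_lin_right
      by (simp add: algebra_simps power2_eq_square)
    moreover have "inner_on V ?w ?w = inner_on V x x + 2 * t * inner_on V x z + t\<^sup>2 * p"
      unfolding inner_on_lin_left inner_on_lin_right p_def inner_on_commute[of V z x]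
      by (simp add: algebra_simps power2_eq_square)
    moreover have "inner_on V ?w (B ?w) \<le> k * inner_on V ?w ?w"
      using psd[of ?w] by (simp add: B_def)
    moreover have "inner_on V x (B x) = k * inner_on V x x"
      using tight by (simp add: B_def)
    ultimately have "0 \<le> 2 * t * (k * inner_on V x z - inner_on V x (B z))
        + t\<^sup>2 * (k * p - inner_on V z (B z))"
      using adj by (simp add: algebra_simps)
    then show ?thesis using p_eq q_def by simp
  qed
  have "p = 0"
  proof (rule ccontr)
    assume "p \<noteq> 0"
    then have p: "p > 0" using p0 by simp
    \<comment> \<open>The quadratic is minimal at \<open>- p / q\<close>; adding \<open>1\<close> avoids division by zero.\<close>
    define t where "t = p / (q + 1)"
    have t: "t > 0" "t * q < p * 1"
      using p q0 by (auto simp: t_def field_simps)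
    have "0 \<le> t * (t * q - 2 * p)" using quad[of "- t"]
      by (simp add: algebra_simps power2_eq_square)
    then have "t * q - 2 * p \<ge> 0" using t(1) by (simp add: zero_le_mult_iff)
    then show False using t p by simp
  qed
  then have "z u = 0" using inner_on_self_eq_0_iff[OF fin, of z] u by (simp add: p_def)
  then show ?thesis by (simp add: z_def B_def)
qed

text \<open>The Rayleigh quotient attains its maximum on the unit sphere, and the maximizer is an eigenvector. In
the product topology on \<open>'a \<Rightarrow> real\<close> a closed set is compact as soon as every coordinate is confined to
a compact set, so the sphere is cut down to the vectors that vanish outside \<open>V\<close>.\<close>

lemma rayleigh_maximizer:
  assumes fin: "finite V" and ne: "V \<noteq> {}" and sym: "\<And>u w. a u w = a w u"
  obtains k x where "\<exists>u\<in>V. x u \<noteq> 0" "\<And>u. u \<in> V \<Longrightarrow> mat_app V a x u = k * x u"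
    and "\<And>y. inner_on V y (mat_app V a y) \<le> k * inner_on V y y"
proof -
  define S where "S = {x. inner_on V x x = 1} \<inter> (PiE UNIV (\<lambda>u. if u \<in> V then {-1..1::real} else {0}))"
  have coord: "continuous_on UNIV (\<lambda>x. x u)" for u :: 'a
    by (rule continuous_on_product_coordinates)
  have cinner: "continuous_on UNIV (\<lambda>x. inner_on V x x)"
    unfolding inner_on_def by (intro continuous_intros coord)
  have cquad: "continuous_on UNIV (\<lambda>x. inner_on V x (mat_app V a x))"
    unfolding inner_on_def mat_app_def by (intro continuous_intros coord)
  have "compactin (product_topology (\<lambda>u. euclidean) UNIV)
      (PiE UNIV (\<lambda>u::'a. if u \<in> V then {-1..1::real} else {0}))"
    unfolding compactin_PiE by auto
  then have "compact (PiE UNIV (\<lambda>u::'a. if u \<in> V then {-1..1::real} else {0}))"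
    by (simp add: euclidean_product_topology)
  moreover have "closed {x. inner_on V x x = 1}"
    using continuous_closed_preimage[OF cinner closed_UNIV, of "{1}"]
    by (simp add: vimage_def)
  ultimately have compS: "compact S"
    unfolding S_def by (rule closed_Int_compact[rotated])
  obtain v where v: "v \<in> V" using ne by auto
  have "(\<lambda>u. if u = v then 1 else 0) \<in> S"
    using v fin by (auto simp: S_def inner_on_def if_distrib cong: if_cong)
  then have "S \<noteq> {}" by auto
  then obtain x where x: "x \<in> S"
    and max: "\<And>y. y \<in> S \<Longrightarrow> inner_on V y (mat_app V a y) \<le> inner_on V x (mat_app V a x)"
    using continuous_attains_sup[OF compS _ continuous_on_subset[OF cquad]] by blast
  define k where "k = inner_on V x (mat_app V a x)"
  have bound: "inner_on V y (mat_app V a y) \<le> k * inner_on V y y" for y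
  proof (cases "inner_on V y y = 0")
    case True
    then have "\<forall>u\<in>V. y u = 0" using inner_on_self_eq_0_iff[OF fin] by blast
    then have "inner_on V y (mat_app V a y) = 0" by (simp add: inner_on_def)
    then show ?thesis using True by simp
  next
    case False
    define c where "c = sqrt (inner_on V y y)"
    have c: "c > 0" "c\<^sup>2 = inner_on V y y"
      using False inner_on_self_nonneg[of V y] by (auto simp: c_def)
    define y' where "y' u = (if u \<in> V then y u / c else 0)" for u
    have y'_eq: "y' u = inverse c * y u + 0 * y u" if "u \<in> V" for u
      using that by (simp add: y'_def field_simps)
    have yy: "inner_on V y' y' = 1"
    proof -
      have "inner_on V y' y' = inner_on V (\<lambda>u. inverse c * y u + 0 * y u) (\<lambda>u. inverse c * y u + 0 * y u)"
        by (rule inner_on_cong) (rule y'_eq, assumption)+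
      also have "\<dots> = (inverse c)\<^sup>2 * c\<^sup>2"
        unfolding inner_on_lin_left inner_on_lin_right c(2) by (simp add: power2_eq_square)
      also have "\<dots> = 1" using c(1) by (simp add: field_simps)
      finally show ?thesis .
    qed
    have yBy: "c\<^sup>2 * inner_on V y' (mat_app V a y') = inner_on V y (mat_app V a y)"
    proof -
      have "inner_on V y' (mat_app V a y') = inner_on V (\<lambda>u. inverse c * y u + 0 * y u)
          (mat_app V a (\<lambda>u. inverse c * y u + 0 * y u))"
        by (intro inner_on_cong y'_eq fun_cong[OF mat_app_cong])
      also have "\<dots> = (inverse c)\<^sup>2 * inner_on V y (mat_app V a y)"
        unfolding mat_app_lin inner_on_lin_left inner_on_lin_right by (simp add: power2_eq_square)
      finally show ?thesis using c(1) by (simp add: field_simps)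
    qed
    have "\<bar>y' u\<bar> \<le> 1" if "u \<in> V" for u
    proof -
      have "(y' u)\<^sup>2 \<le> inner_on V y' y'"
        unfolding inner_on_def power2_eq_square using that fin
        by (intro member_le_sum) auto
      then show ?thesis using yy by (simp add: abs_square_le_1)
    qed
    then have "y' \<in> S"
      using yy by (auto simp: S_def abs_le_iff minus_le_iff) (simp add: y'_def)
    from max[OF this] have "inner_on V y' (mat_app V a y') \<le> k" by (simp add: k_def)
    then have "c\<^sup>2 * inner_on V y' (mat_app V a y') \<le> c\<^sup>2 * k" by (intro mult_left_mono) auto
    then show ?thesis using yBy c(2) by (simp add: mult.commute)
  qed
  have xx: "inner_on V x x = 1" using x by (simp add: S_def)
  show thesis
  proof (rule that)
    show "\<exists>u\<in>V. x u \<noteq> 0" using xx inner_on_self_eq_0_iff[OF fin, of x] by auto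
    show "mat_app V a x u = k * x u" if "u \<in> V" for u
      by (rule eigenvector_of_tight_rayleigh_bound[OF fin sym bound _ that]) (simp add: xx k_def)
  qed (rule bound)
qed

section \<open>Bordering a matrix by the indicator vector of a set\<close>

text \<open>After substituting \<open>b = (\<mu> - B) y\<close>, the claim is \<open>0 \<le> y \<bullet> (\<mu> - B) (r\<^sup>2 - B\<^sup>2) y\<close>. The operator splits
as \<open>(\<mu> - r) (r\<^sup>2 - B\<^sup>2) + (r - B) (r + B) (r - B)\<close>. The second summand is nonnegative by the
Rayleigh bound at \<open>(r - B) y\<close>, and so is \<open>r\<^sup>2 - B\<^sup>2\<close>, because
\<open>2 r (r\<^sup>2 - B\<^sup>2) = (r - B) (r + B) (r - B) + (r + B) (r - B) (r + B)\<close>.\<close>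

lemma bordered_key_inequality:
  assumes fin: "finite W" and sym: "\<And>u w. B u w = B w u"
    and bound: "\<And>z. \<bar>inner_on W z (mat_app W B z)\<bar> \<le> r * inner_on W z z"
    and r: "0 \<le> r" "r \<le> \<mu>"
    and eq: "\<And>u. u \<in> W \<Longrightarrow> \<mu> * y u = b u + mat_app W B y u"
    and by_eq: "inner_on W b y = \<mu>"
  shows "\<mu> * (\<mu>\<^sup>2 - r\<^sup>2) \<le> \<mu> * inner_on W b b + inner_on W b (mat_app W B b)"
proof -
  define F where "F = mat_app W B"
  define p q m n where "p = inner_on W y y" and "q = inner_on W y (F y)"
    and "m = inner_on W (F y) (F y)" and "n = inner_on W (F y) (F (F y))"
  have sq: "inner_on W (\<lambda>u. \<alpha> * y u + \<beta> * F y u) (\<lambda>u. \<alpha> * y u + \<beta> * F y u)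
      = \<alpha>\<^sup>2 * p + 2 * \<alpha> * \<beta> * q + \<beta>\<^sup>2 * m" for \<alpha> \<beta>
    unfolding p_def q_def m_def F_def using inner_on_krylov(1)[OF sym] .
  have qd: "inner_on W (\<lambda>u. \<alpha> * y u + \<beta> * F y u) (F (\<lambda>u. \<alpha> * y u + \<beta> * F y u))
      = \<alpha>\<^sup>2 * q + 2 * \<alpha> * \<beta> * m + \<beta>\<^sup>2 * n" for \<alpha> \<beta>
    unfolding n_def q_def m_def F_def using inner_on_krylov(2)[OF sym] .
  have bd: "\<bar>\<alpha>\<^sup>2 * q + 2 * \<alpha> * \<beta> * m + \<beta>\<^sup>2 * n\<bar> \<le> r * (\<alpha>\<^sup>2 * p + 2 * \<alpha> * \<beta> * q + \<beta>\<^sup>2 * m)" for \<alpha> \<beta>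
    using bound[of "\<lambda>u. \<alpha> * y u + \<beta> * F y u"] unfolding F_def[symmetric] sq qd .
  have minus: "0 \<le> r^3 * p - r\<^sup>2 * q - r * m + n"
    using bd[of r "-1"] by (simp add: abs_le_iff algebra_simps power2_eq_square power3_eq_cube)
  have plus: "0 \<le> r^3 * p + r\<^sup>2 * q - r * m - n"
    using bd[of r 1] by (simp add: abs_le_iff algebra_simps power2_eq_square power3_eq_cube)
  have norm: "0 \<le> r\<^sup>2 * p - m"
  proof (cases "r = 0")
    \<comment> \<open>If \<open>r = 0\<close> the form of \<open>B\<close> vanishes identically, and polarization at \<open>y\<close> and \<open>B y\<close> gives \<open>m = 0\<close>.\<close>
    case True
    then show ?thesis using bd[of 1 0] bd[of 0 1] bd[of 1 1] by simp
  next
    case False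
    have "0 \<le> r * (r\<^sup>2 * p - m)"
      using plus minus by (simp add: algebra_simps power2_eq_square power3_eq_cube)
    then show ?thesis using False r(1) by (simp add: zero_le_mult_iff)
  qed
  have b_eq: "b u = \<mu> * y u + (-1) * F y u" if "u \<in> W" for u
    using eq[OF that] by (simp add: F_def)
  have bb: "inner_on W b b = \<mu>\<^sup>2 * p - 2 * \<mu> * q + m"
  proof -
    have "inner_on W b b =
        inner_on W (\<lambda>u. \<mu> * y u + (-1) * F y u) (\<lambda>u. \<mu> * y u + (-1) * F y u)"
      by (intro inner_on_cong b_eq)
    then show ?thesis using sq[of \<mu> "-1"] by simp
  qed
  have bFb: "inner_on W b (F b) = \<mu>\<^sup>2 * q - 2 * \<mu> * m + n"
  proof -
    have "F b = F (\<lambda>u. \<mu> * y u + (-1) * F y u)"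
      unfolding F_def by (rule mat_app_cong) (metis b_eq F_def)
    then have "inner_on W b (F b) =
        inner_on W (\<lambda>u. \<mu> * y u + (-1) * F y u) (F (\<lambda>u. \<mu> * y u + (-1) * F y u))"
      by (intro inner_on_cong b_eq) auto
    then show ?thesis using qd[of \<mu> "-1"] by simp
  qed
  have lam: "\<mu> = \<mu> * p - q"
  proof -
    have "inner_on W b y = inner_on W (\<lambda>u. \<mu> * y u + (-1) * F y u) y"
      by (intro inner_on_cong b_eq) auto
    also have "\<dots> = \<mu> * p - q"
      unfolding inner_on_lin_left p_def q_def inner_on_commute[of W "F y" y] by simp
    finally show ?thesis using by_eq by simp
  qed
  have "0 \<le> (\<mu> - r) * (r\<^sup>2 * p - m) + (r^3 * p - r\<^sup>2 * q - r * m + n)"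
    using r(2) norm minus by (metis add_nonneg_nonneg diff_ge_0_iff_ge mult_nonneg_nonneg)
  also have "\<dots> = \<mu> * inner_on W b b + inner_on W b (F b) - (\<mu> * p - q) * (\<mu>\<^sup>2 - r\<^sup>2)"
    unfolding bb bFb by (simp add: algebra_simps power2_eq_square power3_eq_cube)
  also have "\<dots> = \<mu> * inner_on W b b + inner_on W b (F b) - \<mu> * (\<mu>\<^sup>2 - r\<^sup>2)"
    using lam by simp
  finally show ?thesis by (simp add: F_def)
qed

text \<open>The two estimates of \<open>\<beta>\<close> serve different ranges. If \<open>\<mu> < d\<close>, the bound \<open>r d\<close> gives
\<open>\<mu> - r \<le> \<mu> / d\<close>, so \<open>2 d - 1 \<le> \<mu>\<^sup>2 - r\<^sup>2 < \<mu> + r\<close>; then \<open>r > d - 1\<close> and \<open>\<mu>\<^sup>2 \<ge> (d - 1)\<^sup>2 + 2 d - 1 = d\<^sup>2\<close>,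
a contradiction. If \<open>\<mu> \<ge> d\<close>, the bound \<open>d (d - 1) \<le> \<mu> (d - 1)\<close> suffices.\<close>

lemma bordered_arith:
  fixes \<mu> r d \<beta> :: real
  assumes d: "d \<ge> 1" and r: "0 \<le> r" "r < \<mu>"
    and key: "\<mu> * (\<mu>\<^sup>2 - r\<^sup>2) \<le> \<mu> * d + \<beta>"
    and b1: "\<beta> \<le> r * d" and b2: "\<beta> \<le> d * (d - 1)"
    and large: "r\<^sup>2 + 2 * d - 1 \<le> \<mu>\<^sup>2"
  shows "\<mu>\<^sup>2 = r\<^sup>2 + 2 * d - 1" and "d \<le> \<mu>" and "\<mu> * (d - 1) \<le> \<beta>"
proof -
  have lam: "\<mu> > 0" using r by simp
  have "\<mu> * (2 * d - 1) \<le> \<mu> * (\<mu>\<^sup>2 - r\<^sup>2)"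
    using lam large by (intro mult_left_mono) auto
  then show *: "\<mu> * (d - 1) \<le> \<beta>" using key by (simp add: algebra_simps)
  show dl: "d \<le> \<mu>"
  proof (rule ccontr)
    assume "\<not> d \<le> \<mu>"
    then have less: "\<mu> < d" by simp
    have "d * (\<mu> - r) \<le> \<mu>" using * b1 by (simp add: algebra_simps)
    then have "d * (\<mu> - r) * (\<mu> + r) \<le> \<mu> * (\<mu> + r)"
      using lam r by (intro mult_right_mono) auto
    moreover have "d * (2 * d - 1) \<le> d * ((\<mu> - r) * (\<mu> + r))"
      using large d by (intro mult_left_mono) (auto simp: algebra_simps power2_eq_square)
    moreover have "\<mu> * (\<mu> + r) < d * (\<mu> + r)"
      using less lam r by (intro mult_strict_right_mono) auto
    ultimately have "d * (2 * d - 1) < d * (\<mu> + r)" by (simp add: mult.assoc)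
    then have "d - 1 < r" using d less by simp
    then have "(d - 1)\<^sup>2 \<le> r\<^sup>2" using d by (intro power_mono) auto
    then have "d\<^sup>2 \<le> \<mu>\<^sup>2" using large by (simp add: power2_eq_square algebra_simps)
    then show False using less lam d by (simp add: power_mono_iff)
  qed
  have "d * (d - 1) \<le> \<mu> * (d - 1)" using dl d by (intro mult_right_mono) auto
  then have "\<mu> * (\<mu>\<^sup>2 - r\<^sup>2) \<le> \<mu> * (2 * d - 1)"
    using key b2 by (simp add: algebra_simps)
  then have "\<mu>\<^sup>2 - r\<^sup>2 \<le> 2 * d - 1" using lam by simp
  then show "\<mu>\<^sup>2 = r\<^sup>2 + 2 * d - 1" using large by simp
qed

text \<open>The equations on \<open>y\<close> say that \<open>(1, y)\<close> is an eigenvector for \<open>\<mu>\<close> of the matrix obtained from \<open>B\<close> by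
adding a row and a column that are the indicator vector of \<open>N\<close>.\<close>

lemma bordered_bound:
  fixes N :: "'a set"
  assumes fin: "finite W" and sym: "\<And>u w. B u w = B w u"
    and bound: "\<And>z. \<bar>inner_on W z (mat_app W B z)\<bar> \<le> r * inner_on W z z"
    and r: "0 \<le> r" "0 \<le> \<mu>"
    and N: "N \<subseteq> W" "N \<noteq> {}"
    and entries: "\<And>u w. B u w \<le> 1" "\<And>u. B u u = 0"
    and eq: "\<And>u. u \<in> W \<Longrightarrow> \<mu> * y u = of_bool (u \<in> N) + mat_app W B y u"
    and by_eq: "(\<Sum>u\<in>N. y u) = \<mu>"
  defines "d \<equiv> real (card N)"
  shows "\<mu>\<^sup>2 \<le> r\<^sup>2 + 2 * d - 1"
    and "\<lbrakk>2 \<le> card N; \<mu>\<^sup>2 = r\<^sup>2 + 2 * d - 1\<rbrakk>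
      \<Longrightarrow> r = d - 1 \<and> (\<forall>u\<in>N. \<forall>w\<in>N. u \<noteq> w \<longrightarrow> B u w = 1)"
proof -
  define b where "b = (\<lambda>u. of_bool (u \<in> N) :: real)"
  have finN: "finite N" using fin N(1) by (rule finite_subset[rotated])
  have d1: "d \<ge> 1"
    unfolding d_def using N(2) finN by (simp add: Suc_leI card_gt_0_iff)
  have sumN: "(\<Sum>u\<in>W. of_bool (u \<in> N) * f u) = (\<Sum>u\<in>N. f u)" for f :: "'a \<Rightarrow> real"
    using fin N(1) by (intro sum.mono_neutral_cong_right) auto
  have by': "inner_on W b y = \<mu>" by (simp add: inner_on_def b_def sumN by_eq)
  have bb: "inner_on W b b = d"
    unfolding inner_on_def b_def sumN by (simp add: d_def)
  define \<beta> where "\<beta> = inner_on W b (mat_app W B b)"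
  have \<beta>_eq: "\<beta> = (\<Sum>u\<in>N. \<Sum>w\<in>N. B u w)"
    unfolding \<beta>_def inner_on_def mat_app_def b_def sumN
    by (simp add: sumN mult.commute[of _ "of_bool _"])
  have \<beta>1: "\<beta> \<le> r * d" using bound[of b] by (simp add: \<beta>_def bb)
  \<comment> \<open>The deficit of \<open>B\<close> on \<open>N\<close> against the all-positive complete graph.\<close>
  define D where "D u w = of_bool (u \<noteq> w) - B u w" for u w
  have D: "D u w \<ge> 0" for u w using entries by (simp add: D_def)
  have "(\<Sum>w\<in>N. of_bool (u \<noteq> w) :: real) = d - 1" if "u \<in> N" for u
  proof -
    have "(\<Sum>w\<in>N. of_bool (u \<noteq> w) :: real) = (\<Sum>w\<in>N. 1 - of_bool (u = w))"
      by (intro sum.cong) auto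
    also have "\<dots> = d - 1"
      using that finN by (simp add: sum_subtractf d_def of_bool_def)
    finally show ?thesis .
  qed
  then have sumD: "(\<Sum>u\<in>N. \<Sum>w\<in>N. D u w) = d * (d - 1) - \<beta>"
    by (simp add: D_def sum_subtractf \<beta>_eq d_def)
  have \<beta>2: "\<beta> \<le> d * (d - 1)"
    using sumD sum_nonneg[of N "\<lambda>u. \<Sum>w\<in>N. D u w"] D by (simp add: sum_nonneg)
  have main: "\<mu>\<^sup>2 = r\<^sup>2 + 2 * d - 1 \<and> d \<le> \<mu> \<and> \<mu> * (d - 1) \<le> \<beta>" if large: "r\<^sup>2 + 2 * d - 1 \<le> \<mu>\<^sup>2"
  proof -
    have "r\<^sup>2 < \<mu>\<^sup>2" using large d1 by simp
    then have rl: "r < \<mu>" using r by (simp add: power2_less_imp_less)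
    have "\<mu> * (\<mu>\<^sup>2 - r\<^sup>2) \<le> \<mu> * inner_on W b b + inner_on W b (mat_app W B b)"
      using rl eq by (intro bordered_key_inequality[OF fin sym bound r(1) _ _ by']) (auto simp: b_def)
    then have key: "\<mu> * (\<mu>\<^sup>2 - r\<^sup>2) \<le> \<mu> * d + \<beta>" by (simp add: bb \<beta>_def)
    show ?thesis using bordered_arith[OF d1 r(1) rl key \<beta>1 \<beta>2 large] by blast
  qed
  show "\<mu>\<^sup>2 \<le> r\<^sup>2 + 2 * d - 1" using main by linarith
  show "r = d - 1 \<and> (\<forall>u\<in>N. \<forall>w\<in>N. u \<noteq> w \<longrightarrow> B u w = 1)"
    if "2 \<le> card N" and tight: "\<mu>\<^sup>2 = r\<^sup>2 + 2 * d - 1"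
  proof -
    have d2: "d \<ge> 2" using that(1) by (simp add: d_def)
    have 1: "d \<le> \<mu>" "\<mu> * (d - 1) \<le> \<beta>" using main tight by auto
    have "\<mu> * (d - 1) \<le> d * (d - 1)" using 1 \<beta>2 by simp
    then have ld: "\<mu> = d" using d2 1 by simp
    then have "r\<^sup>2 = (d - 1)\<^sup>2" using tight by (simp add: power2_eq_square algebra_simps)
    then have rd: "r = d - 1" using r d2 by (simp add: power2_eq_iff_nonneg)
    have "(\<Sum>u\<in>N. \<Sum>w\<in>N. D u w) = 0"
    proof (rule antisym)
      show "(\<Sum>u\<in>N. \<Sum>w\<in>N. D u w) \<le> 0" using 1 ld sumD by simp
    qed (simp add: sum_nonneg D)
    then have "\<forall>u\<in>N. \<forall>w\<in>N. D u w = 0"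
      using finN D by (simp add: sum_nonneg_eq_0_iff sum_nonneg)
    then show ?thesis using rd by (fastforce simp: D_def)
  qed
qed

section \<open>Spectral radius of a signed graph\<close>

lemma adjacency_entry_commute: "adjacency_entry \<Sigma> u w = adjacency_entry \<Sigma> w u"
  by (simp add: adjacency_entry_def insert_commute)

lemma adjacency_entry_self:
  assumes "is_signed_graph \<Sigma>"
  shows "adjacency_entry \<Sigma> u u = 0"
  using assms by (auto simp: adjacency_entry_def is_signed_graph_def)

lemma adjacency_entry_abs_le:
  assumes "is_signed_graph \<Sigma>"
  shows "\<bar>adjacency_entry \<Sigma> u w\<bar> \<le> 1"
  using assms by (auto simp: adjacency_entry_def is_signed_graph_def)

lemma eigenvalue_adjacency_matrix_iff:
  assumes "is_signed_graph \<Sigma>"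
  shows "eigenvalue (adjacency_matrix \<Sigma>) k \<longleftrightarrow>
    (\<exists>x. (\<exists>u\<in>verts \<Sigma>. x u \<noteq> 0) \<and>
         (\<forall>u\<in>verts \<Sigma>. mat_app (verts \<Sigma>) (adjacency_entry \<Sigma>) x u = k * x u))"
proof -
  define vs where "vs = (SOME vs. distinct vs \<and> set vs = verts \<Sigma>)"
  have "\<exists>vs. distinct vs \<and> set vs = verts \<Sigma>"
    using assms finite_distinct_list unfolding is_signed_graph_def by metis
  then have "distinct vs \<and> set vs = verts \<Sigma>"
    unfolding vs_def by (rule someI_ex)
  then show ?thesis
    using eigenvalue_adjacency_matrix_wrt[of vs \<Sigma> k]
    by (simp add: adjacency_matrix_def vs_def[symmetric] mat_app_def)
qed

lemma finite_eigenvalues: "finite {k. eigenvalue (adjacency_matrix \<Sigma>) k}"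
proof -
  obtain vs where "adjacency_matrix \<Sigma> = adjacency_matrix_wrt vs \<Sigma>"
    unfolding adjacency_matrix_def by blast
  then have "adjacency_matrix \<Sigma> \<in> carrier_mat (length vs) (length vs)"
    by (simp add: adjacency_matrix_wrt_def)
  from card_finite_spectrum(1)[OF this] show ?thesis by (simp add: spectrum_def)
qed

text \<open>The maximum and the minimum of the Rayleigh quotient are eigenvalues; the minimum comes from the
maximizer for the negative of the adjacency matrix.\<close>

lemma rayleigh_eigenvalues:
  assumes sg: "is_signed_graph \<Sigma>" and ne: "verts \<Sigma> \<noteq> {}"
  obtains k l where "eigenvalue (adjacency_matrix \<Sigma>) k" "eigenvalue (adjacency_matrix \<Sigma>) l"
    and "\<And>z. inner_on (verts \<Sigma>) z (mat_app (verts \<Sigma>) (adjacency_entry \<Sigma>) z)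
          \<in> {l * inner_on (verts \<Sigma>) z z..k * inner_on (verts \<Sigma>) z z}"
proof -
  let ?V = "verts \<Sigma>" and ?a = "adjacency_entry \<Sigma>"
  have fin: "finite ?V" using sg by (simp add: is_signed_graph_def)
  obtain k x where k: "\<exists>u\<in>?V. x u \<noteq> 0" "\<And>u. u \<in> ?V \<Longrightarrow> mat_app ?V ?a x u = k * x u"
      "\<And>y. inner_on ?V y (mat_app ?V ?a y) \<le> k * inner_on ?V y y"
    by (rule rayleigh_maximizer[of ?V ?a, OF fin ne adjacency_entry_commute]) blast
  have neg_commute: "- ?a u w = - ?a w u" for u w
    by (subst adjacency_entry_commute) (rule refl)
  obtain l y where l: "\<exists>u\<in>?V. y u \<noteq> 0"
      "\<And>u. u \<in> ?V \<Longrightarrow> mat_app ?V (\<lambda>u w. - ?a u w) y u = l * y u"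
      "\<And>z. inner_on ?V z (mat_app ?V (\<lambda>u w. - ?a u w) z) \<le> l * inner_on ?V z z"
    by (rule rayleigh_maximizer[of ?V "\<lambda>u w. - ?a u w", OF fin ne neg_commute]) blast
  show thesis
  proof (rule that)
    show "eigenvalue (adjacency_matrix \<Sigma>) k"
      using k by (auto simp: eigenvalue_adjacency_matrix_iff[OF sg])
    have "mat_app ?V ?a y u = (- l) * y u" if "u \<in> ?V" for u
      using l(2)[OF that] by (simp add: mat_app_uminus minus_equation_iff)
    then show "eigenvalue (adjacency_matrix \<Sigma>) (- l)"
      using l(1) by (auto simp: eigenvalue_adjacency_matrix_iff[OF sg])
    show "inner_on ?V z (mat_app ?V ?a z) \<in> {- l * inner_on ?V z z..k * inner_on ?V z z}" for z
    proof -
      have "inner_on ?V z (\<lambda>u. - mat_app ?V ?a z u) = - inner_on ?V z (mat_app ?V ?a z)"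
        by (simp add: inner_on_def sum_negf)
      then show ?thesis using k(3)[of z] l(3)[of z] by (simp add: mat_app_uminus)
    qed
  qed
qed

lemma spectral_radius_rayleigh_bound:
  assumes sg: "is_signed_graph \<Sigma>" and ne: "verts \<Sigma> \<noteq> {}"
  shows "\<bar>inner_on (verts \<Sigma>) z (mat_app (verts \<Sigma>) (adjacency_entry \<Sigma>) z)\<bar>
    \<le> sg_spectral_radius \<Sigma> * inner_on (verts \<Sigma>) z z"
proof -
  let ?p = "inner_on (verts \<Sigma>) z z"
  let ?q = "inner_on (verts \<Sigma>) z (mat_app (verts \<Sigma>) (adjacency_entry \<Sigma>) z)"
  obtain k l where kl: "eigenvalue (adjacency_matrix \<Sigma>) k" "eigenvalue (adjacency_matrix \<Sigma>) l"
    and q: "l * ?p \<le> ?q" "?q \<le> k * ?p"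
    using rayleigh_eigenvalues[OF sg ne] by (metis atLeastAtMost_iff)
  have "k \<le> sg_spectral_radius \<Sigma>" "- l \<le> sg_spectral_radius \<Sigma>"
    using kl Max_ge[OF finite_eigenvalues, of k \<Sigma>] Min_le[OF finite_eigenvalues, of l \<Sigma>]
    by (auto simp: sg_spectral_radius_def largest_eigenvalue_def least_eigenvalue_def le_max_iff_disj)
  then have "k * ?p \<le> sg_spectral_radius \<Sigma> * ?p" "- l * ?p \<le> sg_spectral_radius \<Sigma> * ?p"
    using inner_on_self_nonneg by (metis mult_right_mono)+
  then show ?thesis using q by (simp add: abs_le_iff)
qed

lemma spectral_radius_eigenvector:
  assumes sg: "is_signed_graph \<Sigma>" and ne: "verts \<Sigma> \<noteq> {}"
  obtains s x where "s = 1 \<or> s = (-1 :: real)" "\<exists>u\<in>verts \<Sigma>. x u \<noteq> 0"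
    "\<And>u. u \<in> verts \<Sigma> \<Longrightarrow>
      mat_app (verts \<Sigma>) (adjacency_entry \<Sigma>) x u = s * sg_spectral_radius \<Sigma> * x u"
proof -
  let ?E = "{k. eigenvalue (adjacency_matrix \<Sigma>) k}"
  obtain k where "eigenvalue (adjacency_matrix \<Sigma>) k"
    by (rule rayleigh_eigenvalues[OF sg ne])
  then have "?E \<noteq> {}" by blast
  then have "largest_eigenvalue \<Sigma> \<in> ?E" "least_eigenvalue \<Sigma> \<in> ?E"
    unfolding largest_eigenvalue_def least_eigenvalue_def
    by (rule Max_in[OF finite_eigenvalues], rule Min_in[OF finite_eigenvalues])
  moreover have "1 * sg_spectral_radius \<Sigma> = largest_eigenvalue \<Sigma>
      \<or> (-1) * sg_spectral_radius \<Sigma> = least_eigenvalue \<Sigma>"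
    by (auto simp: sg_spectral_radius_def max_def)
  ultimately have "\<exists>s. (s = 1 \<or> s = (-1::real)) \<and>
      eigenvalue (adjacency_matrix \<Sigma>) (s * sg_spectral_radius \<Sigma>)"
    by (metis mem_Collect_eq)
  then obtain s :: real where s: "s = 1 \<or> s = -1"
    and "eigenvalue (adjacency_matrix \<Sigma>) (s * sg_spectral_radius \<Sigma>)"
    by blast
  then obtain x where x: "\<exists>u\<in>verts \<Sigma>. x u \<noteq> 0" "\<forall>u\<in>verts \<Sigma>.
      mat_app (verts \<Sigma>) (adjacency_entry \<Sigma>) x u = s * sg_spectral_radius \<Sigma> * x u"
    unfolding eigenvalue_adjacency_matrix_iff[OF sg] by blast
  show thesis using s x(1) bspec[OF x(2)] by (rule that)
qed

lemma spectral_radius_nonneg: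
  assumes sg: "is_signed_graph \<Sigma>" and ne: "verts \<Sigma> \<noteq> {}"
  shows "0 \<le> sg_spectral_radius \<Sigma>"
proof -
  have "inner_on (verts \<Sigma>) (\<lambda>_. 1) (\<lambda>_. 1) > 0"
    using sg ne by (simp add: inner_on_def is_signed_graph_def card_gt_0_iff)
  moreover have "0 \<le> sg_spectral_radius \<Sigma> * inner_on (verts \<Sigma>) (\<lambda>_. 1) (\<lambda>_. 1)"
    using spectral_radius_rayleigh_bound[OF assms] abs_ge_zero by (rule order_trans[rotated])
  ultimately show ?thesis by (simp add: zero_le_mult_iff)
qed

section \<open>Deleting a vertex\<close>

lemma is_signed_graph_delete_vertex:
  "is_signed_graph \<Sigma> \<Longrightarrow> is_signed_graph (delete_vertex \<Sigma> v)"
  by (auto simp: is_signed_graph_def delete_vertex_def)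

lemma adjacency_entry_delete_vertex:
  "\<lbrakk>u \<noteq> v; w \<noteq> v\<rbrakk> \<Longrightarrow> adjacency_entry (delete_vertex \<Sigma> v) u w = adjacency_entry \<Sigma> u w"
  by (auto simp: adjacency_entry_def delete_vertex_def)

lemma delete_vertex_rayleigh_bound:
  assumes sg: "is_signed_graph \<Sigma>" and ne: "verts \<Sigma> - {v} \<noteq> {}"
  defines "W \<equiv> verts \<Sigma> - {v}"
  shows "\<bar>inner_on W z (mat_app W (adjacency_entry \<Sigma>) z)\<bar>
    \<le> sg_spectral_radius (delete_vertex \<Sigma> v) * inner_on W z z"
proof -
  have verts: "verts (delete_vertex \<Sigma> v) = W" by (simp add: delete_vertex_def W_def)
  have "inner_on W z (mat_app W (adjacency_entry (delete_vertex \<Sigma> v)) z)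
      = inner_on W z (mat_app W (adjacency_entry \<Sigma>) z)"
    unfolding mat_app_def
    by (intro inner_on_cong sum.cong refl) (simp add: adjacency_entry_delete_vertex W_def)
  then show ?thesis
    using spectral_radius_rayleigh_bound[OF is_signed_graph_delete_vertex[OF sg], of v z] ne
    unfolding verts by (simp add: W_def)
qed

definition switching_sign :: "'a set \<Rightarrow> 'a \<Rightarrow> real" where
  "switching_sign S u = (if u \<in> S then -1 else 1)"

lemma switching_sign_square [simp]: "switching_sign S u * switching_sign S u = 1"
  by (simp add: switching_sign_def)

lemma adjacency_entry_at_vertex:
  assumes sg: "is_signed_graph \<Sigma>"
  shows "adjacency_entry \<Sigma> u v =
    of_bool (u \<in> neighbours \<Sigma> v) * switching_sign (neg_neighbours \<Sigma> v) u"
  using sg by (auto simp: adjacency_entry_def neighbours_def neg_neighbours_def switching_sign_def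
      is_signed_graph_def)

text \<open>Reduction to \<open>bordered_bound\<close>: the adjacency matrix is multiplied by the sign \<open>s\<close> of the extreme
eigenvalue and conjugated by the diagonal matrix with entry \<open>s\<close> at \<open>v\<close> and \<open>\<tau>\<close> elsewhere. This makes
the eigenvalue nonnegative and the row of \<open>v\<close> the indicator vector of its neighbours, and changes the
set of Rayleigh quotients of the deleted matrix at most by a sign.\<close>

lemma spectral_radius_delete_vertex:
  assumes sg: "is_signed_graph \<Sigma>" and v: "v \<in> verts \<Sigma>" and N: "neighbours \<Sigma> v \<noteq> {}"
  defines "\<rho> \<equiv> sg_spectral_radius \<Sigma>" and "r \<equiv> sg_spectral_radius (delete_vertex \<Sigma> v)"
    and "d \<equiv> real (vertex_degree \<Sigma> v)" and "\<tau> \<equiv> switching_sign (neg_neighbours \<Sigma> v)"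
  shows "\<rho>\<^sup>2 \<le> r\<^sup>2 + 2 * d - 1"
    and "\<lbrakk>2 \<le> vertex_degree \<Sigma> v; \<rho>\<^sup>2 = r\<^sup>2 + 2 * d - 1\<rbrakk> \<Longrightarrow> r = d - 1 \<and>
      (\<exists>s. (s = 1 \<or> s = -1) \<and> (\<forall>u\<in>neighbours \<Sigma> v. \<forall>w\<in>neighbours \<Sigma> v. u \<noteq> w \<longrightarrow>
        \<tau> u * \<tau> w * adjacency_entry \<Sigma> u w = s))"
proof -
  let ?a = "adjacency_entry \<Sigma>" and ?N = "neighbours \<Sigma> v"
  define W where "W = verts \<Sigma> - {v}"
  have V: "verts \<Sigma> = insert v W" using v by (auto simp: W_def)
  have finW: "finite W" and vW: "v \<notin> W" using sg by (auto simp: W_def is_signed_graph_def)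
  have NW: "?N \<subseteq> W"
    using sg by (auto simp: neighbours_def W_def is_signed_graph_def)
  have finN: "finite ?N" using NW finW by (rule finite_subset)
  have d1: "d \<ge> 1" using N finN by (simp add: d_def vertex_degree_def Suc_leI card_gt_0_iff)
  have neW: "verts \<Sigma> - {v} \<noteq> {}" using NW N by (auto simp: W_def)
  have rho0: "0 \<le> \<rho>" unfolding \<rho>_def using sg v by (intro spectral_radius_nonneg) auto
  have r0: "0 \<le> r" unfolding r_def using sg neW
    by (intro spectral_radius_nonneg is_signed_graph_delete_vertex) (auto simp: delete_vertex_def)
  have bound: "\<bar>inner_on W z (mat_app W ?a z)\<bar> \<le> r * inner_on W z z" for z
    using delete_vertex_rayleigh_bound[OF sg neW] by (simp add: r_def W_def)
  obtain s x where s: "s = 1 \<or> s = (-1 :: real)" and x0: "\<exists>u\<in>verts \<Sigma>. x u \<noteq> 0"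
    and x: "\<And>u. u \<in> verts \<Sigma> \<Longrightarrow> mat_app (verts \<Sigma>) ?a x u = s * \<rho> * x u"
    using spectral_radius_eigenvector[OF sg] v unfolding \<rho>_def by blast
  have ss: "s * s = 1" using s by auto
  have split: "mat_app (verts \<Sigma>) ?a x u = ?a u v * x v + mat_app W ?a x u" for u
    unfolding V mat_app_def using finW vW by simp
  have tau: "\<tau> u * \<tau> u = 1" for u by (simp add: \<tau>_def)
  have a_v: "?a u v = of_bool (u \<in> ?N) * \<tau> u" for u
    unfolding \<tau>_def by (rule adjacency_entry_at_vertex[OF sg])
  have "\<rho>\<^sup>2 \<le> r\<^sup>2 + 2 * d - 1 \<and> (2 \<le> vertex_degree \<Sigma> v \<and> \<rho>\<^sup>2 = r\<^sup>2 + 2 * d - 1 \<longrightarrow> r = d - 1 \<and>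
      (\<exists>s. (s = 1 \<or> s = -1) \<and> (\<forall>u\<in>?N. \<forall>w\<in>?N. u \<noteq> w \<longrightarrow> \<tau> u * \<tau> w * ?a u w = s)))"
  proof (cases "x v = 0")
    case True
    have "inner_on W x (mat_app W ?a x) = s * \<rho> * inner_on W x x"
      unfolding inner_on_def sum_distrib_left
      using x split True V by (intro sum.cong) (auto simp: algebra_simps)
    then have "\<rho> * inner_on W x x \<le> r * inner_on W x x"
      using bound[of x] s rho0 inner_on_self_nonneg[of W x] by (auto simp: abs_mult)
    moreover have "inner_on W x x \<noteq> 0"
      using x0 True V inner_on_self_eq_0_iff[OF finW, of x] by auto
    ultimately have "\<rho> \<le> r" using inner_on_self_nonneg[of W x] by simp
    then have "\<rho>\<^sup>2 \<le> r\<^sup>2" using rho0 by (intro power_mono)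
    then show ?thesis using d1 by simp
  next
    case False
    define y where "y u = s * \<tau> u * x u / x v" for u
    define B where "B u w = s * \<tau> u * \<tau> w * ?a u w" for u w
    have symB: "B u w = B w u" for u w
      unfolding B_def adjacency_entry_commute[of \<Sigma> u w] by simp
    have Bz: "mat_app W B z u = s * \<tau> u * mat_app W ?a (\<lambda>w. \<tau> w * z w) u" for z u
      by (simp add: mat_app_def B_def sum_distrib_left algebra_simps)
    have tz: "inner_on W (\<lambda>u. \<tau> u * z u) (\<lambda>u. \<tau> u * z u) = inner_on W z z" for z
    proof -
      have "\<tau> u * z u * (\<tau> u * z u) = (\<tau> u * \<tau> u) * (z u * z u)" for u by simp
      then show ?thesis by (simp only: inner_on_def tau) simp
    qed
    have boundB: "\<bar>inner_on W z (mat_app W B z)\<bar> \<le> r * inner_on W z z" for z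
    proof -
      have "inner_on W z (mat_app W B z)
          = s * inner_on W (\<lambda>u. \<tau> u * z u) (mat_app W ?a (\<lambda>u. \<tau> u * z u))"
        by (simp add: inner_on_def Bz sum_distrib_left algebra_simps)
      moreover have "\<bar>s\<bar> = 1" using s by auto
      ultimately show ?thesis using bound[of "\<lambda>u. \<tau> u * z u"] by (simp add: abs_mult tz)
    qed
    have B1: "B u w \<le> 1" for u w
    proof -
      have "\<bar>B u w\<bar> = \<bar>?a u w\<bar>" using s by (auto simp: B_def abs_mult \<tau>_def switching_sign_def)
      then show ?thesis using adjacency_entry_abs_le[OF sg, of u w] by linarith
    qed
    have B0: "B u u = 0" for u by (simp add: B_def adjacency_entry_self[OF sg])
    have eq: "\<rho> * y u = of_bool (u \<in> ?N) + mat_app W B y u" if u: "u \<in> W" for u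
    proof -
      have ty: "(\<lambda>w. \<tau> w * y w) = (\<lambda>w. (s / x v) * x w + 0 * x w)"
        by (auto simp: y_def fun_eq_iff mult.assoc[symmetric] tau mult.commute[of _ s])
      have "mat_app W B y u = \<tau> u * (s * s) * mat_app W ?a x u / x v"
        unfolding Bz ty mat_app_lin by simp
      also have "\<dots> = \<tau> u * (s * \<rho> * x u - ?a u v * x v) / x v"
        using x[of u] split[of u] u V ss by simp
      also have "\<dots> = \<rho> * y u - of_bool (u \<in> ?N)"
        using False tau[of u] by (simp add: y_def a_v field_simps)
      finally show ?thesis by simp
    qed
    have sumy: "(\<Sum>u\<in>?N. y u) = \<rho>"
    proof -
      have "(\<Sum>u\<in>?N. \<tau> u * x u) = (\<Sum>u\<in>W. ?a v u * x u)"
        using finW NW by (intro sum.mono_neutral_cong_left)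
          (auto simp: adjacency_entry_commute[of \<Sigma> v] a_v)
      also have "\<dots> = s * \<rho> * x v"
        using x[OF v] split[of v] by (simp add: adjacency_entry_self[OF sg] mat_app_def)
      finally have *: "(\<Sum>u\<in>?N. \<tau> u * x u) = s * \<rho> * x v" .
      have "(\<Sum>u\<in>?N. y u) = s / x v * (\<Sum>u\<in>?N. \<tau> u * x u)"
        by (simp add: y_def sum_distrib_left mult.assoc)
      also have "\<dots> = (s * s) * \<rho>" using False * by simp
      finally show ?thesis using ss by simp
    qed
    note bb = bordered_bound[OF finW symB boundB r0 rho0 NW N B1 B0 eq sumy, folded vertex_degree_def, folded d_def]
    have "\<exists>s. (s = 1 \<or> s = -1) \<and> (\<forall>u\<in>?N. \<forall>w\<in>?N. u \<noteq> w \<longrightarrow> \<tau> u * \<tau> w * ?a u w = s)"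
      if "\<forall>u\<in>?N. \<forall>w\<in>?N. u \<noteq> w \<longrightarrow> B u w = 1"
    proof (intro exI[of _ s] conjI ballI impI s)
      fix u w assume "u \<in> ?N" "w \<in> ?N" "u \<noteq> w"
      then have "s * B u w = s" using that by simp
      then show "\<tau> u * \<tau> w * ?a u w = s" using ss by (simp add: B_def mult.assoc[symmetric])
    qed
    then show ?thesis using bb by blast
  qed
  then show "\<rho>\<^sup>2 \<le> r\<^sup>2 + 2 * d - 1"
    and "\<lbrakk>2 \<le> vertex_degree \<Sigma> v; \<rho>\<^sup>2 = r\<^sup>2 + 2 * d - 1\<rbrakk> \<Longrightarrow> r = d - 1 \<and>
      (\<exists>s. (s = 1 \<or> s = -1) \<and> (\<forall>u\<in>?N. \<forall>w\<in>?N. u \<noteq> w \<longrightarrow> \<tau> u * \<tau> w * ?a u w = s))"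
    by blast+
qed

section \<open>Complete neighbourhoods and the case of equality\<close>

text \<open>The vector \<open>z\<close> below is the eigenvector of the switched complete graph on \<open>v\<close> and its neighbours. Its
entry at \<open>v\<close> is \<open>s\<close>, since for \<open>s = -1\<close> one also has to switch at \<open>v\<close> to give all edges the same sign.\<close>

lemma spectral_radius_ge_complete_neighbourhood:
  assumes sg: "is_signed_graph \<Sigma>" and v: "v \<in> verts \<Sigma>" and s: "s = 1 \<or> s = -1"
  defines "\<tau> \<equiv> switching_sign (neg_neighbours \<Sigma> v)"
  assumes complete: "\<And>u w. \<lbrakk>u \<in> neighbours \<Sigma> v; w \<in> neighbours \<Sigma> v; u \<noteq> w\<rbrakk>
    \<Longrightarrow> \<tau> u * \<tau> w * adjacency_entry \<Sigma> u w = s"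
  shows "real (vertex_degree \<Sigma> v) \<le> sg_spectral_radius \<Sigma>"
proof -
  let ?a = "adjacency_entry \<Sigma>" and ?N = "neighbours \<Sigma> v"
  let ?V = "verts \<Sigma>" and ?K = "insert v (neighbours \<Sigma> v)"
  define d where "d = real (vertex_degree \<Sigma> v)"
  have fin: "finite ?V" using sg by (simp add: is_signed_graph_def)
  have vN: "v \<notin> ?N" using sg by (auto simp: neighbours_def is_signed_graph_def)
  have KV: "?K \<subseteq> ?V" using v by (auto simp: neighbours_def)
  have finN: "finite ?N" using KV fin by (auto intro: finite_subset)
  have cardK: "real (card ?K) = d + 1"
    using vN finN by (simp add: d_def vertex_degree_def)
  define \<theta> where "\<theta> u = (if u = v then s else \<tau> u)" for u
  have theta: "\<theta> u * \<theta> u = 1" for u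
    using s by (auto simp: \<theta>_def \<tau>_def)
  have a_v: "?a u v = of_bool (u \<in> ?N) * \<tau> u" for u
    unfolding \<tau>_def by (rule adjacency_entry_at_vertex[OF sg])
  have tau: "\<tau> u * \<tau> u = 1" for u by (simp add: \<tau>_def)
  have entry: "\<theta> u * ?a u w * \<theta> w = s" if uw: "u \<in> ?K" "w \<in> ?K" "u \<noteq> w" for u w
  proof -
    have at_v: "\<theta> u * ?a u v * \<theta> v = s" if "u \<in> ?N" for u
      using that vN tau[of u] by (auto simp: \<theta>_def a_v)
    consider "u = v" "w \<in> ?N" | "w = v" "u \<in> ?N" | "u \<in> ?N" "w \<in> ?N" "u \<noteq> v" "w \<noteq> v"
      using uw vN by blast
    then show ?thesis
    proof cases
      case 1
      then show ?thesis using at_v[of w] by (simp add: adjacency_entry_commute[of \<Sigma> v] mult_ac)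
    next
      case 2
      then show ?thesis using at_v[of u] by simp
    next
      case 3
      then show ?thesis using complete[of u w] uw by (simp add: \<theta>_def mult_ac)
    qed
  qed
  define z where "z u = (if u \<in> ?K then \<theta> u else 0)" for u
  have zz: "inner_on ?V z z = d + 1"
  proof -
    have "inner_on ?V z z = (\<Sum>u\<in>?K. 1)"
      unfolding inner_on_def using fin KV by (intro sum.mono_neutral_cong_right) (auto simp: z_def theta)
    then show ?thesis using cardK by simp
  qed
  have row: "z u * mat_app ?V ?a z u = s * d" if u: "u \<in> ?K" for u
  proof -
    have "z u * mat_app ?V ?a z u = (\<Sum>w\<in>?V. z u * ?a u w * z w)"
      by (simp add: mat_app_def sum_distrib_left mult.assoc)
    also have "\<dots> = (\<Sum>w\<in>?K - {u}. s)"
      using fin KV entry[OF u] u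
      by (intro sum.mono_neutral_cong_right) (auto simp: z_def adjacency_entry_self[OF sg])
    also have "\<dots> = real (card (?K - {u})) * s" by simp
    also have "real (card (?K - {u})) = d"
    proof -
      have "Suc (card (?K - {u})) = card ?K" using u finN by (intro card_Suc_Diff1) auto
      then show ?thesis using cardK by linarith
    qed
    finally show ?thesis by simp
  qed
  have zAz: "inner_on ?V z (mat_app ?V ?a z) = (d + 1) * (s * d)"
  proof -
    have "inner_on ?V z (mat_app ?V ?a z) = (\<Sum>u\<in>?K. s * d)"
      unfolding inner_on_def using fin KV row
      by (intro sum.mono_neutral_cong_right) (auto simp: z_def)
    then show ?thesis using cardK by simp
  qed
  have d0: "d \<ge> 0" by (simp add: d_def)
  have "\<bar>(d + 1) * (s * d)\<bar> = (d + 1) * d" using s d0 by (auto simp: abs_mult)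
  moreover have "\<bar>(d + 1) * (s * d)\<bar> \<le> sg_spectral_radius \<Sigma> * (d + 1)"
    using spectral_radius_rayleigh_bound[OF sg, of z] v zAz zz by auto
  ultimately have "(d + 1) * d \<le> (d + 1) * sg_spectral_radius \<Sigma>" by (simp add: mult.commute)
  then have "d \<le> sg_spectral_radius \<Sigma>" using d0 by (simp add: mult_le_cancel_left)
  then show ?thesis by (simp add: d_def)
qed

text \<open>Switching is conjugation by the diagonal matrix \<open>switching_sign S\<close>. Since the value on the right is
not \<open>0\<close>, the equation on the left also says that \<open>u\<close> and \<open>w\<close> are adjacent.\<close>

lemma switched_entry_iff:
  assumes sg: "is_signed_graph \<Sigma>" and ne: "u \<noteq> w" and s: "s = 1 \<or> s = -1"
  shows "switching_sign S u * switching_sign S w * adjacency_entry \<Sigma> u w = of_int s \<longleftrightarrow>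
    {u, w} \<in> edges (switching \<Sigma> S) \<and> signed_graph.sign (switching \<Sigma> S) {u, w} = s"
proof -
  have "{u, w} \<inter> S = (if u \<in> S then {u} else {}) \<union> (if w \<in> S then {w} else {})" by auto
  then have "card ({u, w} \<inter> S) = 1 \<longleftrightarrow> (u \<in> S) \<noteq> (w \<in> S)"
    using ne by auto
  moreover have "signed_graph.sign \<Sigma> {u, w} = 1 \<or> signed_graph.sign \<Sigma> {u, w} = -1" if "{u, w} \<in> edges \<Sigma>"
    using sg that by (auto simp: is_signed_graph_def)
  ultimately show ?thesis
    using s by (auto simp: switching_sign_def adjacency_entry_def switching_def)
qed

text \<open>The complete graph with constant sign is invariant under all permutations of its vertices, so any
bijection onto them serves as the isomorphism.\<close>

lemma induced_isomorphic_complete_iff: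
  assumes N: "finite N" "N \<subseteq> verts \<Gamma>" and edges: "\<And>e. e \<in> edges \<Gamma> \<Longrightarrow> card e = 2"
  shows "sg_isomorphic (induced \<Gamma> N) (complete_signed_graph (card N) s) \<longleftrightarrow>
    (\<forall>u\<in>N. \<forall>w\<in>N. u \<noteq> w \<longrightarrow> {u, w} \<in> edges \<Gamma> \<and> signed_graph.sign \<Gamma> {u, w} = s)"
    (is "?L \<longleftrightarrow> ?R")
proof -
  have verts: "verts (induced \<Gamma> N) = N" using N by (auto simp: induced_def)
  have ind_edge: "{u, w} \<in> edges (induced \<Gamma> N) \<longleftrightarrow> {u, w} \<in> edges \<Gamma>" if "u \<in> N" "w \<in> N" for u w
    using that by (auto simp: induced_def)
  have loop: "{u, u} \<notin> edges \<Gamma>" for u using edges[of "{u, u}"] by auto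
  have com_edge: "{f u, f w} \<in> edges (complete_signed_graph (card N) s) \<longleftrightarrow> u \<noteq> w"
    if "bij_betw f N {..<card N}" "u \<in> N" "w \<in> N" for f u w
  proof -
    have "f u < card N" "f w < card N" "f u = f w \<longleftrightarrow> u = w"
      using that by (auto simp: bij_betw_def inj_on_def)
    then show ?thesis by (auto simp: complete_signed_graph_def card_2_iff)
  qed
  have sign: "signed_graph.sign (induced \<Gamma> N) = signed_graph.sign \<Gamma>" "signed_graph.sign (complete_signed_graph (card N) s) e = s"
    "verts (complete_signed_graph (card N) s) = {..<card N}" for e
    by (auto simp: induced_def complete_signed_graph_def)
  show ?thesis
  proof
    assume ?L
    then obtain f where f: "bij_betw f N {..<card N}"
      and iso: "\<And>u w. \<lbrakk>u \<in> N; w \<in> N\<rbrakk> \<Longrightarrow>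
        ({u, w} \<in> edges (induced \<Gamma> N) \<longleftrightarrow> {f u, f w} \<in> edges (complete_signed_graph (card N) s)) \<and>
        ({u, w} \<in> edges (induced \<Gamma> N) \<longrightarrow> signed_graph.sign \<Gamma> {u, w} = s)"
      unfolding sg_isomorphic_def verts sign by blast
    show ?R using iso com_edge[OF f] ind_edge by blast
  next
    assume R: ?R
    obtain f where f: "bij_betw f N {..<card N}"
      using N(1) by (metis ex_bij_betw_finite_nat atLeast0LessThan)
    have "({u, w} \<in> edges (induced \<Gamma> N) \<longleftrightarrow> {f u, f w} \<in> edges (complete_signed_graph (card N) s)) \<and>
        ({u, w} \<in> edges (induced \<Gamma> N) \<longrightarrow> signed_graph.sign \<Gamma> {u, w} = s)" if "u \<in> N" "w \<in> N" for u w
      using R that com_edge[OF f that] ind_edge[OF that] loop[of u] by metis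
    then show ?L unfolding sg_isomorphic_def verts sign using f by blast
  qed
qed

theorem theorem3p8:
  fixes \<Sigma> :: "'a signed_graph" and v :: 'a
  assumes "is_signed_graph \<Sigma>"
    and "v \<in> verts \<Sigma>"
    and "neighbours \<Sigma> v \<noteq> {}"
  shows "sg_spectral_radius \<Sigma> \<le>
           sqrt ((sg_spectral_radius (delete_vertex \<Sigma> v))\<^sup>2 + 2 * real (vertex_degree \<Sigma> v) - 1)
    \<and> (vertex_degree \<Sigma> v \<ge> 2 \<longrightarrow>
        (sg_spectral_radius \<Sigma> =
           sqrt ((sg_spectral_radius (delete_vertex \<Sigma> v))\<^sup>2 + 2 * real (vertex_degree \<Sigma> v) - 1)
         \<longleftrightarrow>
         (let \<Sigma>' = switching \<Sigma> (neg_neighbours \<Sigma> v);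
              H = induced \<Sigma>' (neighbours \<Sigma> v);
              d = vertex_degree \<Sigma> v
          in (sg_isomorphic H (complete_signed_graph d 1)
              \<or> sg_isomorphic H (complete_signed_graph d (-1)))
             \<and> sg_spectral_radius (delete_vertex \<Sigma> v) = real d - 1)))"
proof -
  note sg = assms(1)
  let ?N = "neighbours \<Sigma> v" and ?S = "neg_neighbours \<Sigma> v"
  define \<rho> r d where "\<rho> = sg_spectral_radius \<Sigma>" and "r = sg_spectral_radius (delete_vertex \<Sigma> v)"
    and "d = real (vertex_degree \<Sigma> v)"
  define complete where "complete s \<longleftrightarrow> (\<forall>u\<in>?N. \<forall>w\<in>?N. u \<noteq> w \<longrightarrow>
    switching_sign ?S u * switching_sign ?S w * adjacency_entry \<Sigma> u w = s)" for s
  have rho0: "0 \<le> \<rho>" unfolding \<rho>_def using assms by (intro spectral_radius_nonneg) auto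
  have upper: "\<rho>\<^sup>2 \<le> r\<^sup>2 + 2 * d - 1"
    using spectral_radius_delete_vertex(1)[OF assms] by (simp add: \<rho>_def r_def d_def)
  have tight: "r = d - 1 \<and> (complete 1 \<or> complete (-1))"
    if "2 \<le> vertex_degree \<Sigma> v" "\<rho>\<^sup>2 = r\<^sup>2 + 2 * d - 1"
    using spectral_radius_delete_vertex(2)[OF assms] that
    unfolding \<rho>_def r_def d_def complete_def by blast
  have lower: "d \<le> \<rho>" if "complete 1 \<or> complete (-1)"
    using that spectral_radius_ge_complete_neighbourhood[OF assms(1,2)]
    unfolding complete_def d_def \<rho>_def by blast
  have "\<rho>\<^sup>2 = r\<^sup>2 + 2 * d - 1" if "complete 1 \<or> complete (-1)" "r = d - 1"
  proof (rule antisym[OF upper])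
    have "d\<^sup>2 \<le> \<rho>\<^sup>2" using lower[OF that(1)] by (intro power_mono) (auto simp: d_def)
    then show "r\<^sup>2 + 2 * d - 1 \<le> \<rho>\<^sup>2" by (simp add: that(2) power2_eq_square algebra_simps)
  qed
  then have iff: "\<rho>\<^sup>2 = r\<^sup>2 + 2 * d - 1 \<longleftrightarrow> (complete 1 \<or> complete (-1)) \<and> r = d - 1"
    if "2 \<le> vertex_degree \<Sigma> v" using tight that by blast
  have iso: "sg_isomorphic (induced (switching \<Sigma> ?S) ?N) (complete_signed_graph (vertex_degree \<Sigma> v) s)
      \<longleftrightarrow> complete (of_int s)" if s: "s = 1 \<or> s = -1" for s
  proof -
    have "finite ?N" "?N \<subseteq> verts (switching \<Sigma> ?S)"
      "\<And>e. e \<in> edges (switching \<Sigma> ?S) \<Longrightarrow> card e = 2"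
      using sg by (auto simp: neighbours_def switching_def is_signed_graph_def)
    from induced_isomorphic_complete_iff[OF this, of s] show ?thesis
      unfolding complete_def vertex_degree_def using switched_entry_iff[OF sg _ s] by (metis (no_types))
  qed
  have sqrt_eq: "\<rho> = sqrt (r\<^sup>2 + 2 * d - 1) \<longleftrightarrow> \<rho>\<^sup>2 = r\<^sup>2 + 2 * d - 1"
    using rho0 upper by (metis order_trans real_sqrt_pow2 real_sqrt_unique zero_le_power2)
  show ?thesis
    unfolding Let_def iso[of 1, simplified] iso[of "-1", simplified]
      \<rho>_def[symmetric] r_def[symmetric] d_def[symmetric] sqrt_eq
    using upper iff by (auto intro: real_le_rsqrt)
qed

end
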